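(* Each of the following hereditary classes of graphs interprets grids: (1) the class of bichain graphs; (2) the class of split permutation graphs; (3) the class of bipartite permutation graphs; (4) the class of unit interval graphs.
   Context: Graphs are finite, simple, undirected. For a vertex $v$, $N(v)$ is its neighbourhood. A sequence $v_1,\dots,v_k$ of vertices is a chain if $N(v_i)\subseteq N(v_j)$ whenever $i\le j$. A bipartite graph with parts $A,B$ is a $k$-chain graph if each of $A$ and $B$ can be partitioned into at most $k$ chains; a bichain graph is a $2$-chain graph. A split graph is one whose vertex set can be partitioned into a clique and an independent set; split permutation graphs are graphs that are both split graphs and permutation graphs; bipartite permutation graphs are graphs that are both bipartite and permutation graphs; unit interval graphs are intersection graphs of families of intervals of unit length on the real line. An $\mathrm{MSO}$ interpretation with parameters $\bar Z$ (set variables) is a pair $\Psi(\bar Z)=(\psi(x,\bar Z),\psi_E(x,y,\bar Z))$ of $\mathrm{MSO}$ formulas over graphs; for a graph $G$ and subsets $\bar A$ of $V(G)$, $\Psi((G,\bar A))$ has vertex set $\{a:G\models\psi(a,\bar A)\}$ and edge relation $\{(a,b):G\models\psi_E(a,b,\bar A)\}$, and $\Psi(\mathcal{C})=\{\Psi((G,\bar A)): G\in\mathcal{C}, \bar A \text{ arbitrary}\}$. A class $\mathcal{C}$ interprets grids if there is an $\mathrm{MSO}$ interpretation $\Phi$ such that $\Phi(\mathcal{C})$ contains isomorphic copies of arbitrarily large square grids (the $n\times n$ grid has vertices $(i,j)$, $1\le i,j\le n$, with $(i,j)$ adjacent to $(i,j+1)$ and $(i+1,j)$ when these exist). *)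

theory Defs
  imports
    "Graph_Theory.Pair_Digraph"
    "Graph_Theory.Digraph_Isomorphism"
    "HOL-Combinatorics.Permutations"
    Complex_Main
begin

text \<open>
  A finite simple undirected graph is a \<^const>\<open>pair_graph\<close>: a finite vertex set \<^const>\<open>pverts\<close>
  with a symmetric, irreflexive set \<^const>\<open>parcs\<close> of ordered pairs of vertices, an undirected edge
  being represented by both of its orientations.
\<close>

definition neighbourhood :: "'a pair_pre_digraph \<Rightarrow> 'a \<Rightarrow> 'a set" where
  "neighbourhood G v = {u. (v, u) \<in> parcs G}"

definition independent_set :: "'a pair_pre_digraph \<Rightarrow> 'a set \<Rightarrow> bool" where
  "independent_set G S \<longleftrightarrow> S \<subseteq> pverts G \<and> (\<forall>u\<in>S. \<forall>v\<in>S. (u, v) \<notin> parcs G)"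

definition clique :: "'a pair_pre_digraph \<Rightarrow> 'a set \<Rightarrow> bool" where
  "clique G S \<longleftrightarrow> S \<subseteq> pverts G \<and> (\<forall>u\<in>S. \<forall>v\<in>S. u \<noteq> v \<longrightarrow> (u, v) \<in> parcs G)"

definition hereditary :: "'a pair_pre_digraph set \<Rightarrow> bool" where
  "hereditary C \<longleftrightarrow>
    (\<forall>G\<in>C. \<forall>H. induced_subgraph (with_proj H) (with_proj G) \<longrightarrow> H \<in> C)"


subsection \<open>Graph classes\<close>

definition bipartition :: "'a pair_pre_digraph \<Rightarrow> 'a set \<Rightarrow> 'a set \<Rightarrow> bool" where
  "bipartition G A B \<longleftrightarrow>
    A \<union> B = pverts G \<and> A \<inter> B = {} \<and> independent_set G A \<and> independent_set G B"

definition bipartite_graph :: "'a pair_pre_digraph \<Rightarrow> bool" where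
  "bipartite_graph G \<longleftrightarrow> pair_graph G \<and> (\<exists>A B. bipartition G A B)"

definition split_graph :: "'a pair_pre_digraph \<Rightarrow> bool" where
  "split_graph G \<longleftrightarrow> pair_graph G \<and>
    (\<exists>K I. K \<union> I = pverts G \<and> K \<inter> I = {} \<and> clique G K \<and> independent_set G I)"

definition chain :: "'a pair_pre_digraph \<Rightarrow> 'a list \<Rightarrow> bool" where
  "chain G vs \<longleftrightarrow> set vs \<subseteq> pverts G \<and>
    (\<forall>i j. i \<le> j \<and> j < length vs \<longrightarrow> neighbourhood G (vs ! i) \<subseteq> neighbourhood G (vs ! j))"

definition partition_into_chains :: "'a pair_pre_digraph \<Rightarrow> nat \<Rightarrow> 'a set \<Rightarrow> bool" where
  "partition_into_chains G k A \<longleftrightarrow>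
    (\<exists>cs. length cs \<le> k \<and> (\<forall>c\<in>set cs. chain G c) \<and>
          distinct (concat cs) \<and> set (concat cs) = A)"

definition k_chain_graph :: "nat \<Rightarrow> 'a pair_pre_digraph \<Rightarrow> bool" where
  "k_chain_graph k G \<longleftrightarrow> pair_graph G \<and>
    (\<exists>A B. bipartition G A B \<and> partition_into_chains G k A \<and> partition_into_chains G k B)"

definition bichain_graph :: "'a pair_pre_digraph \<Rightarrow> bool" where
  "bichain_graph G \<longleftrightarrow> k_chain_graph 2 G"

text \<open>
  The vertices are numbered \<open>1, \<dots>, n\<close> by \<open>f\<close>, and the edges are the pairs inverted by \<open>\<pi>\<close>.
\<close>
definition permutation_graph :: "'a pair_pre_digraph \<Rightarrow> bool" where
  "permutation_graph G \<longleftrightarrow> pair_graph G \<and>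
    (\<exists>f \<pi>. bij_betw f (pverts G) {1..card (pverts G)} \<and> \<pi> permutes {1..card (pverts G)} \<and>
      (\<forall>u\<in>pverts G. \<forall>v\<in>pverts G.
        (u, v) \<in> parcs G \<longleftrightarrow>
          (f u < f v \<and> \<pi> (f v) < \<pi> (f u)) \<or> (f v < f u \<and> \<pi> (f u) < \<pi> (f v))))"

definition unit_interval_graph :: "'a pair_pre_digraph \<Rightarrow> bool" where
  "unit_interval_graph G \<longleftrightarrow> pair_graph G \<and>
    (\<exists>l :: 'a \<Rightarrow> real. \<forall>u\<in>pverts G. \<forall>v\<in>pverts G.
      (u, v) \<in> parcs G \<longleftrightarrow> u \<noteq> v \<and> {l u..l u + 1} \<inter> {l v..l v + 1} \<noteq> {})"


subsection \<open>Monadic second-order logic over graphs\<close>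

text \<open>
  Vertex variables and vertex-set variables are two separate sorts, each named by natural numbers.
  The remaining connectives and the universal quantifiers are definable from the ones listed.
\<close>
datatype mso =
    Eq nat nat
  | Adj nat nat
  | Mem nat nat
  | Neg mso
  | Conj mso mso
  | ExV nat mso
  | ExS nat mso

primrec sat :: "'a pair_pre_digraph \<Rightarrow> (nat \<Rightarrow> 'a) \<Rightarrow> (nat \<Rightarrow> 'a set) \<Rightarrow> mso \<Rightarrow> bool" where
  "sat G e s (Eq x y) \<longleftrightarrow> e x = e y"
| "sat G e s (Adj x y) \<longleftrightarrow> (e x, e y) \<in> parcs G"
| "sat G e s (Mem x X) \<longleftrightarrow> e x \<in> s X"
| "sat G e s (Neg \<phi>) \<longleftrightarrow> \<not> sat G e s \<phi>"
| "sat G e s (Conj \<phi> \<psi>) \<longleftrightarrow> sat G e s \<phi> \<and> sat G e s \<psi>"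
| "sat G e s (ExV x \<phi>) \<longleftrightarrow> (\<exists>v\<in>pverts G. sat G (e(x := v)) s \<phi>)"
| "sat G e s (ExS X \<phi>) \<longleftrightarrow> (\<exists>S\<subseteq>pverts G. sat G e (s(X := S)) \<phi>)"

primrec free_vertex_vars :: "mso \<Rightarrow> nat set" where
  "free_vertex_vars (Eq x y) = {x, y}"
| "free_vertex_vars (Adj x y) = {x, y}"
| "free_vertex_vars (Mem x X) = {x}"
| "free_vertex_vars (Neg \<phi>) = free_vertex_vars \<phi>"
| "free_vertex_vars (Conj \<phi> \<psi>) = free_vertex_vars \<phi> \<union> free_vertex_vars \<psi>"
| "free_vertex_vars (ExV x \<phi>) = free_vertex_vars \<phi> - {x}"
| "free_vertex_vars (ExS X \<phi>) = free_vertex_vars \<phi>"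

primrec free_set_vars :: "mso \<Rightarrow> nat set" where
  "free_set_vars (Eq x y) = {}"
| "free_set_vars (Adj x y) = {}"
| "free_set_vars (Mem x X) = {X}"
| "free_set_vars (Neg \<phi>) = free_set_vars \<phi>"
| "free_set_vars (Conj \<phi> \<psi>) = free_set_vars \<phi> \<union> free_set_vars \<psi>"
| "free_set_vars (ExV x \<phi>) = free_set_vars \<phi>"
| "free_set_vars (ExS X \<phi>) = free_set_vars \<phi> - {X}"


subsection \<open>Interpretations\<close>

record mso_interp =
  num_params :: nat
  vertex_formula :: mso
  edge_formula :: mso

text \<open>
  Vertex variables \<open>0\<close> and \<open>1\<close> play the roles of \<open>x\<close> and \<open>y\<close>; set variables
  \<open>0, \<dots>, num_params - 1\<close> are the parameters.
\<close>
definition mso_interpretation :: "mso_interp \<Rightarrow> bool" where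
  "mso_interpretation \<Psi> \<longleftrightarrow>
    free_vertex_vars (vertex_formula \<Psi>) \<subseteq> {0} \<and>
    free_vertex_vars (edge_formula \<Psi>) \<subseteq> {0, 1} \<and>
    free_set_vars (vertex_formula \<Psi>) \<subseteq> {..<num_params \<Psi>} \<and>
    free_set_vars (edge_formula \<Psi>) \<subseteq> {..<num_params \<Psi>}"

definition interp_verts :: "mso_interp \<Rightarrow> 'a pair_pre_digraph \<Rightarrow> 'a set list \<Rightarrow> 'a set" where
  "interp_verts \<Psi> G As =
    {a \<in> pverts G. sat G ((\<lambda>_. undefined)(0 := a)) (\<lambda>i. As ! i) (vertex_formula \<Psi>)}"

text \<open>The edge relation is the one defined by the edge formula on the new vertex set.\<close>
definition interp_graph ::
    "mso_interp \<Rightarrow> 'a pair_pre_digraph \<Rightarrow> 'a set list \<Rightarrow> 'a pair_pre_digraph" where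
  "interp_graph \<Psi> G As =
    \<lparr> pverts = interp_verts \<Psi> G As,
      parcs = {(a, b). a \<in> interp_verts \<Psi> G As \<and> b \<in> interp_verts \<Psi> G As \<and>
        sat G ((\<lambda>_. undefined)(0 := a, 1 := b)) (\<lambda>i. As ! i) (edge_formula \<Psi>)} \<rparr>"

definition interp_class :: "mso_interp \<Rightarrow> 'a pair_pre_digraph set \<Rightarrow> 'a pair_pre_digraph set" where
  "interp_class \<Psi> C =
    {interp_graph \<Psi> G As | G As.
      G \<in> C \<and> length As = num_params \<Psi> \<and> (\<forall>A\<in>set As. A \<subseteq> pverts G)}"

definition square_grid :: "nat \<Rightarrow> (nat \<times> nat) pair_pre_digraph" where
  "square_grid n =
    (let V = {1..n} \<times> {1..n};
         R = {((i, j), (i, j + 1)) | i j. True} \<union> {((i, j), (i + 1, j)) | i j. True}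
     in \<lparr> pverts = V, parcs = (R \<union> R\<inverse>) \<inter> V \<times> V \<rparr>)"

definition interprets_grids :: "'a pair_pre_digraph set \<Rightarrow> bool" where
  "interprets_grids C \<longleftrightarrow>
    (\<exists>\<Phi>. mso_interpretation \<Phi> \<and>
      (\<forall>m. \<exists>n\<ge>m. \<exists>H\<in>interp_class \<Phi> C.
        digraph_iso (with_proj H) (with_proj (square_grid n))))"

end

theory Submission
  imports Defs
begin

text \<open>
  One interpretation serves all four classes. Arrange the vertices of a host graph in columns and
  colour the columns cyclically with four colours, so that every vertex \<open>x\<close> has a set of forward
  neighbours: its neighbours of the next colour. In each host, adjacency between consecutive
  columns is given by a threshold on the heights. Hence, for \<open>x\<close> and \<open>x'\<close> of the same colour, the
  forward neighbourhood of \<open>x\<close> exceeds that of \<open>x'\<close> by a single vertex \<open>y\<close> exactly if \<open>x'\<close> is the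
  next vertex below (or, in some columns, above) \<open>x\<close> and \<open>y\<close> has the height of \<open>x\<close> in the next
  column. The pairs \<open>x, x'\<close> and \<open>x, y\<close> that arise in this way are the vertical and the horizontal
  edges of a grid. For unit interval graphs and bipartite permutation graphs the thresholds are
  local; for bichain graphs and split permutation graphs, columns of the same colour are
  concatenated into a single chain, so that a vertex also sees many columns far away, but those
  cancel in the difference of the two neighbourhoods.
\<close>

section \<open>Heredity\<close>

text \<open>The arc equation forces both ends of every arc of \<open>H\<close> into
  \<open>pverts H\<close>, so well-formedness of \<open>H\<close> follows from the right-hand
  side.\<close>

lemma induced_subgraph_with_proj_iff:
  "induced_subgraph (with_proj H) (with_proj G) \<longleftrightarrow>
    pair_wf_digraph G \<and> pverts H \<subseteq> pverts G \<and>
    parcs H = {(u, v) \<in> parcs G. u \<in> pverts H \<and> v \<in> pverts H}"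
proof -
  have "pair_wf_digraph H"
    if "parcs H = {(u, v) \<in> parcs G. u \<in> pverts H \<and> v \<in> pverts H}"
    by unfold_locales (auto simp: that)
  then show ?thesis
    unfolding induced_subgraph_def subgraph_def compatible_def wf_digraph_wp_iff with_proj_simps
    by fastforce
qed

lemma pair_graph_iff:
  "pair_graph G \<longleftrightarrow> finite (pverts G) \<and>
    (\<forall>u v. (u, v) \<in> parcs G \<longrightarrow> u \<in> pverts G \<and> v \<in> pverts G \<and> u \<noteq> v \<and> (v, u) \<in> parcs G)"
proof
  assume "pair_graph G"
  then interpret pair_graph G .
  show "finite (pverts G) \<and>
    (\<forall>u v. (u, v) \<in> parcs G \<longrightarrow> u \<in> pverts G \<and> v \<in> pverts G \<and> u \<noteq> v \<and> (v, u) \<in> parcs G)"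
    using pair_finite_verts in_arcsD1 in_arcsD2 no_loops' arcs_symmetric by blast
next
  assume *: "finite (pverts G) \<and>
    (\<forall>u v. (u, v) \<in> parcs G \<longrightarrow> u \<in> pverts G \<and> v \<in> pverts G \<and> u \<noteq> v \<and> (v, u) \<in> parcs G)"
  then have "parcs G \<subseteq> pverts G \<times> pverts G" by auto
  then have "finite (parcs G)" using * by (meson finite_SigmaI finite_subset)
  moreover have "sym (parcs G)" using * by (auto intro: symI)
  ultimately show "pair_graph G"
    using * by unfold_locales (simp_all add: symmetric_def split_paired_all)
qed

context
  fixes G H :: "'a pair_pre_digraph"
  assumes induced: "induced_subgraph (with_proj H) (with_proj G)"
begin

lemma induced_pverts: "pverts H \<subseteq> pverts G"
  using induced by (simp add: induced_subgraph_with_proj_iff)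

lemma induced_parcs:
  "(u, v) \<in> parcs H \<longleftrightarrow> (u, v) \<in> parcs G \<and> u \<in> pverts H \<and> v \<in> pverts H"
  using induced by (auto simp: induced_subgraph_with_proj_iff)

lemma pair_graph_induced: "pair_graph G \<Longrightarrow> pair_graph H"
  using induced_pverts by (auto simp: pair_graph_iff induced_parcs intro: finite_subset)

lemma independent_set_induced:
  "independent_set G S \<Longrightarrow> independent_set H (S \<inter> pverts H)"
  by (auto simp: independent_set_def induced_parcs)

lemma clique_induced: "clique G S \<Longrightarrow> clique H (S \<inter> pverts H)"
  by (auto simp: clique_def induced_parcs)

lemma bipartition_induced:
  assumes "bipartition G A B"
  shows "bipartition H (A \<inter> pverts H) (B \<inter> pverts H)"
  using assms induced_pverts
  by (auto simp: bipartition_def intro: independent_set_induced)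

lemma bipartite_graph_induced: "bipartite_graph G \<Longrightarrow> bipartite_graph H"
  unfolding bipartite_graph_def using pair_graph_induced bipartition_induced by blast

lemma split_graph_induced:
  assumes "split_graph G" shows "split_graph H"
proof -
  obtain K I where "K \<union> I = pverts G" "K \<inter> I = {}" "clique G K" "independent_set G I"
    using assms by (auto simp: split_graph_def)
  then have "(K \<inter> pverts H) \<union> (I \<inter> pverts H) = pverts H" "(K \<inter> pverts H) \<inter> (I \<inter> pverts H) = {}"
    "clique H (K \<inter> pverts H)" "independent_set H (I \<inter> pverts H)"
    using induced_pverts clique_induced independent_set_induced by auto
  then show ?thesis
    using assms pair_graph_induced unfolding split_graph_def by blast
qed

lemma unit_interval_graph_induced: "unit_interval_graph G \<Longrightarrow> unit_interval_graph H"
  unfolding unit_interval_graph_def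
  using pair_graph_induced induced_pverts by (auto simp: induced_parcs subset_iff)

end

text \<open>Indices \<open>i = j\<close> contribute only reflexivity of inclusion. The
  \<open>sorted_wrt\<close> form is stable under \<open>filter\<close>, which is how a chain is
  restricted to an induced subgraph.\<close>

lemma chain_iff_sorted_wrt:
  "chain G vs \<longleftrightarrow> set vs \<subseteq> pverts G \<and>
    sorted_wrt (\<lambda>u v. neighbourhood G u \<subseteq> neighbourhood G v) vs"
proof -
  have "(\<forall>i j. i \<le> j \<and> j < length vs \<longrightarrow> neighbourhood G (vs ! i) \<subseteq> neighbourhood G (vs ! j))
    \<longleftrightarrow> (\<forall>i j. i < j \<longrightarrow> j < length vs \<longrightarrow> neighbourhood G (vs ! i) \<subseteq> neighbourhood G (vs ! j))"
    by (metis le_eq_less_or_eq order_refl)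
  then show ?thesis
    unfolding chain_def sorted_wrt_iff_nth_less by simp
qed

text \<open>The neighbourhood in \<open>H\<close> of a vertex of \<open>H\<close> is its
  neighbourhood in \<open>G\<close> cut down to \<open>pverts H\<close>, so inclusions
  survive.\<close>

lemma chain_induced:
  assumes "induced_subgraph (with_proj H) (with_proj G)" and "chain G vs"
  shows "chain H (filter (\<lambda>v. v \<in> pverts H) vs)"
proof -
  have "sorted_wrt (\<lambda>u v. neighbourhood G u \<subseteq> neighbourhood G v) (filter (\<lambda>v. v \<in> pverts H) vs)"
    using assms(2) sorted_wrt_filter by (auto simp: chain_iff_sorted_wrt)
  then have "sorted_wrt (\<lambda>u v. neighbourhood H u \<subseteq> neighbourhood H v)
      (filter (\<lambda>v. v \<in> pverts H) vs)"
    by (rule sorted_wrt_mono_rel[rotated])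
      (auto simp: neighbourhood_def induced_parcs[OF assms(1)])
  then show ?thesis by (auto simp: chain_iff_sorted_wrt)
qed

lemma partition_into_chains_induced:
  assumes ind: "induced_subgraph (with_proj H) (with_proj G)"
    and "partition_into_chains G k A"
  shows "partition_into_chains H k (A \<inter> pverts H)"
proof -
  obtain cs where cs: "length cs \<le> k" "\<forall>c\<in>set cs. chain G c" "distinct (concat cs)"
    "set (concat cs) = A"
    using assms(2) by (auto simp: partition_into_chains_def)
  let ?ds = "map (filter (\<lambda>v. v \<in> pverts H)) cs"
  have eq: "concat ?ds = filter (\<lambda>v. v \<in> pverts H) (concat cs)"
    by (simp add: filter_concat)
  have "length ?ds \<le> k" "\<forall>c\<in>set ?ds. chain H c" "distinct (concat ?ds)"
    using cs chain_induced[OF ind] by (auto simp: eq simp del: set_concat)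
  moreover have "set (concat ?ds) = A \<inter> pverts H"
    unfolding eq using cs(4) by auto
  ultimately show ?thesis unfolding partition_into_chains_def by blast
qed

lemma bichain_graph_induced:
  assumes "induced_subgraph (with_proj H) (with_proj G)" and "bichain_graph G"
  shows "bichain_graph H"
  using assms(2) pair_graph_induced[OF assms(1)] bipartition_induced[OF assms(1)]
    partition_into_chains_induced[OF assms(1)]
  unfolding bichain_graph_def k_chain_graph_def by blast

section \<open>Permutation graphs\<close>

text \<open>Counting the elements whose key is at most that of \<open>u\<close> ranks
  \<open>V\<close> by key; this turns injective integer keys into a numbering by
  \<open>{1..card V}\<close>.\<close>

lemma rank_bij_betw:
  fixes a :: "'a \<Rightarrow> int"
  assumes "finite V" and "inj_on a V"
  obtains r where "bij_betw r V {1..card V}"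
    and "\<And>u v. u \<in> V \<Longrightarrow> v \<in> V \<Longrightarrow> r u < r v \<longleftrightarrow> a u < a v"
proof -
  define r where "r u = card {w \<in> V. a w \<le> a u}" for u
  have less: "r u < r v" if "u \<in> V" "v \<in> V" "a u < a v" for u v
    unfolding r_def
  proof (rule psubset_card_mono)
    show "finite {w \<in> V. a w \<le> a v}" using assms(1) by simp
    show "{w \<in> V. a w \<le> a u} \<subset> {w \<in> V. a w \<le> a v}" using that by force
  qed
  have iff: "r u < r v \<longleftrightarrow> a u < a v" if "u \<in> V" "v \<in> V" for u v
    using less[of u v] less[of v u] that inj_onD[OF assms(2), of u v]
    by (metis linorder_less_linear less_irrefl less_asym)
  have inj: "inj_on r V"
  proof (rule inj_onI)
    fix u v assume "u \<in> V" "v \<in> V" "r u = r v"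
    then have "a u = a v" using iff[of u v] iff[of v u] by simp
    then show "u = v" using assms(2) \<open>u \<in> V\<close> \<open>v \<in> V\<close> by (simp add: inj_on_eq_iff)
  qed
  have "r ` V \<subseteq> {1..card V}"
  proof
    fix k assume "k \<in> r ` V"
    then obtain u where u: "u \<in> V" "k = r u" by auto
    have "u \<in> {w \<in> V. a w \<le> a u}" using u by simp
    then have "r u > 0" unfolding r_def using assms(1) by (auto simp: card_gt_0_iff)
    moreover have "r u \<le> card V" unfolding r_def by (rule card_mono) (use assms(1) in auto)
    ultimately show "k \<in> {1..card V}" using u by simp
  qed
  moreover have "card (r ` V) = card {1..card V}" using card_image[OF inj] by simp
  ultimately have "r ` V = {1..card V}" by (simp add: card_subset_eq)
  with inj iff show thesis using that by (auto simp: bij_betw_def)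
qed

text \<open>Unlike the numbering in the definition, injective keys restrict to induced subgraphs.\<close>
lemma permutation_graph_iff_keys:
  "permutation_graph G \<longleftrightarrow> pair_graph G \<and>
    (\<exists>(a :: 'a \<Rightarrow> int) (b :: 'a \<Rightarrow> int). inj_on a (pverts G) \<and> inj_on b (pverts G) \<and>
      (\<forall>u\<in>pverts G. \<forall>v\<in>pverts G.
        (u, v) \<in> parcs G \<longleftrightarrow> (a u < a v \<and> b v < b u) \<or> (a v < a u \<and> b u < b v)))"
  (is "_ \<longleftrightarrow> _ \<and> ?keys")
proof
  let ?V = "pverts G"
  assume "permutation_graph G"
  then obtain f \<pi> where pg: "pair_graph G" and f: "bij_betw f ?V {1..card ?V}"
    and \<pi>: "\<pi> permutes {1..card ?V}"
    and adj: "\<forall>u\<in>?V. \<forall>v\<in>?V. (u, v) \<in> parcs G \<longleftrightarrow>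
          (f u < f v \<and> \<pi> (f v) < \<pi> (f u)) \<or> (f v < f u \<and> \<pi> (f u) < \<pi> (f v))"
    unfolding permutation_graph_def by blast
  have "inj_on f ?V" using f by (rule bij_betw_imp_inj_on)
  then have "inj_on (\<lambda>u. int (f u)) ?V" "inj_on (\<lambda>u. int (\<pi> (f u))) ?V"
    using permutes_inj[OF \<pi>] by (auto simp: inj_on_def)
  moreover have "\<forall>u\<in>?V. \<forall>v\<in>?V. (u, v) \<in> parcs G \<longleftrightarrow>
      (int (f u) < int (f v) \<and> int (\<pi> (f v)) < int (\<pi> (f u))) \<or>
      (int (f v) < int (f u) \<and> int (\<pi> (f u)) < int (\<pi> (f v)))"
    using adj by simp
  ultimately have ?keys by blast
  with pg show "pair_graph G \<and> ?keys" ..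
next
  let ?V = "pverts G"
  assume *: "pair_graph G \<and> ?keys"
  then obtain a b :: "'a \<Rightarrow> int" where ab: "inj_on a ?V" "inj_on b ?V"
    and adj: "\<And>u v. u \<in> ?V \<Longrightarrow> v \<in> ?V \<Longrightarrow>
      (u, v) \<in> parcs G \<longleftrightarrow> (a u < a v \<and> b v < b u) \<or> (a v < a u \<and> b u < b v)"
    by blast
  have fin: "finite ?V" using * by (simp add: pair_graph_iff)
  obtain f where f: "bij_betw f ?V {1..card ?V}"
    "\<And>u v. u \<in> ?V \<Longrightarrow> v \<in> ?V \<Longrightarrow> f u < f v \<longleftrightarrow> a u < a v"
    using rank_bij_betw[OF fin ab(1)] by metis
  obtain g where g: "bij_betw g ?V {1..card ?V}"
    "\<And>u v. u \<in> ?V \<Longrightarrow> v \<in> ?V \<Longrightarrow> g u < g v \<longleftrightarrow> b u < b v"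
    using rank_bij_betw[OF fin ab(2)] by metis
  \<comment> \<open>\<open>\<pi>\<close> carries the rank of a vertex by \<open>a\<close> to its
    rank by \<open>b\<close>; \<open>permutes\<close> demands the identity outside the
    range.\<close>
  define \<pi> where "\<pi> k = (if k \<in> {1..card ?V} then g (inv_into ?V f k) else k)" for k
  have "bij_betw (g \<circ> inv_into ?V f) {1..card ?V} {1..card ?V}"
    using bij_betw_trans[OF bij_betw_inv_into[OF f(1)] g(1)] .
  then have "bij_betw \<pi> {1..card ?V} {1..card ?V}"
    by (rule iffD1[OF bij_betw_cong, rotated]) (simp add: \<pi>_def)
  then have perm: "\<pi> permutes {1..card ?V}"
    by (rule bij_imp_permutes) (simp add: \<pi>_def del: atLeastAtMost_iff)
  have "\<pi> (f u) = g u" if "u \<in> ?V" for u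
    using f(1) that bij_betw_apply[OF f(1) that]
    by (simp add: \<pi>_def bij_betw_inv_into_left[OF f(1)] del: atLeastAtMost_iff)
  then have "\<forall>u\<in>?V. \<forall>v\<in>?V. (u, v) \<in> parcs G \<longleftrightarrow>
          (f u < f v \<and> \<pi> (f v) < \<pi> (f u)) \<or> (f v < f u \<and> \<pi> (f u) < \<pi> (f v))"
    by (simp add: adj f(2) g(2))
  with * f(1) perm show "permutation_graph G"
    unfolding permutation_graph_def by blast
qed

lemma permutation_graph_induced:
  assumes ind: "induced_subgraph (with_proj H) (with_proj G)" and "permutation_graph G"
  shows "permutation_graph H"
proof -
  obtain a b :: "'a \<Rightarrow> int" where "pair_graph G" "inj_on a (pverts G)" "inj_on b (pverts G)"
    and "\<forall>u\<in>pverts G. \<forall>v\<in>pverts G.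
      (u, v) \<in> parcs G \<longleftrightarrow> (a u < a v \<and> b v < b u) \<or> (a v < a u \<and> b u < b v)"
    using assms(2) unfolding permutation_graph_iff_keys by blast
  then have "pair_graph H" "inj_on a (pverts H)" "inj_on b (pverts H)"
    and "\<forall>u\<in>pverts H. \<forall>v\<in>pverts H.
      (u, v) \<in> parcs H \<longleftrightarrow> (a u < a v \<and> b v < b u) \<or> (a v < a u \<and> b u < b v)"
    using induced_pverts[OF ind] pair_graph_induced[OF ind]
    by (auto simp: induced_parcs[OF ind] subset_iff intro: inj_on_subset)
  then show ?thesis
    unfolding permutation_graph_iff_keys by blast
qed

section \<open>The interpretation\<close>

definition disj :: "mso \<Rightarrow> mso \<Rightarrow> mso" where
  "disj \<phi> \<psi> = Neg (Conj (Neg \<phi>) (Neg \<psi>))"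

definition same_colour_fm :: "nat \<Rightarrow> nat \<Rightarrow> mso" where
  "same_colour_fm x y =
    disj (disj (Conj (Mem x 0) (Mem y 0)) (Conj (Mem x 1) (Mem y 1)))
      (disj (Conj (Mem x 2) (Mem y 2)) (Conj (Mem x 3) (Mem y 3)))"

definition forward_fm :: "nat \<Rightarrow> nat \<Rightarrow> mso" where
  "forward_fm x y = Conj (Adj x y)
    (disj (disj (Conj (Mem x 0) (Mem y 1)) (Conj (Mem x 1) (Mem y 2)))
      (disj (Conj (Mem x 2) (Mem y 3)) (Conj (Mem x 3) (Mem y 0))))"

text \<open>The bound variable \<open>z\<close> is an argument because variables are plain numbers:
  it has to be chosen different from the other three, or the quantifier would capture them.\<close>

definition sole_fm :: "nat \<Rightarrow> nat \<Rightarrow> nat \<Rightarrow> nat \<Rightarrow> mso" where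
  "sole_fm x x' y z =
    Conj (Conj (same_colour_fm x x') (Conj (forward_fm x y) (Neg (forward_fm x' y))))
      (Neg (ExV z (Conj (Conj (forward_fm x z) (Neg (forward_fm x' z))) (Neg (Eq z y)))))"

text \<open>Parameters \<open>0\<close> to \<open>3\<close> are meant for the colour classes and
  \<open>4\<close> for the grid vertices. The first two disjuncts quantify the horizontal partner
  away and give the vertical edges; the last two quantify the vertical partner away and give the
  horizontal ones. Each kind occurs in both orientations for symmetry.\<close>

definition grid_interp :: mso_interp where
  "grid_interp = \<lparr> num_params = 5, vertex_formula = Mem 0 4,
    edge_formula = disj
      (disj (ExV 2 (sole_fm 0 1 2 3)) (ExV 2 (sole_fm 1 0 2 3)))
      (disj (ExV 2 (sole_fm 0 2 1 3)) (ExV 2 (sole_fm 1 2 0 3))) \<rparr>"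

lemma mso_interpretation_grid_interp: "mso_interpretation grid_interp"
  by (auto simp: mso_interpretation_def grid_interp_def disj_def sole_fm_def forward_fm_def
      same_colour_fm_def)

lemma sat_disj [simp]: "sat G e s (disj \<phi> \<psi>) \<longleftrightarrow> sat G e s \<phi> \<or> sat G e s \<psi>"
  by (simp add: disj_def)

section \<open>Host graphs\<close>

definition graph_on :: "nat \<Rightarrow> (nat \<Rightarrow> nat \<Rightarrow> bool) \<Rightarrow> nat pair_pre_digraph" where
  "graph_on L R = \<lparr> pverts = {..<L}, parcs = {(u, v). u < L \<and> v < L \<and> R u v} \<rparr>"

lemma graph_on_simps [simp]:
  "pverts (graph_on L R) = {..<L}"
  "(u, v) \<in> parcs (graph_on L R) \<longleftrightarrow> u < L \<and> v < L \<and> R u v"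
  by (simp_all add: graph_on_def)

lemma pair_graph_graph_on:
  assumes "\<And>u v. R u v \<Longrightarrow> u \<noteq> v \<and> R v u"
  shows "pair_graph (graph_on L R)"
  using assms by (auto simp: pair_graph_iff)

text \<open>
  The number \<open>v = i * (n + 2) + j\<close> with \<open>j < n + 2\<close> stands for the vertex of height \<open>j\<close> in column
  \<open>i\<close>. The cells are the grid vertices. Heights \<open>0\<close> and \<open>n + 1\<close> and the last column are
  guards: they keep the neighbours \<open>x - 1\<close>, \<open>x + 1\<close> and \<open>x + (n + 2)\<close> of a cell \<open>x\<close> in the host.
\<close>

definition host_size :: "nat \<Rightarrow> nat" where
  "host_size n = (n + 1) * (n + 2)"

text \<open>The differences -1, 0 and 1 are distinct modulo 4, so colours orient adjacent columns;
  as 4 is even, the colour also determines the parity of the column.\<close>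

definition colour :: "nat \<Rightarrow> nat \<Rightarrow> nat" where
  "colour n v = v div (n + 2) mod 4"

definition cells :: "nat \<Rightarrow> nat set" where
  "cells n = {i * (n + 2) + j | i j. i < n \<and> 1 \<le> j \<and> j \<le> n}"

definition forward :: "nat \<Rightarrow> (nat \<Rightarrow> nat \<Rightarrow> bool) \<Rightarrow> nat \<Rightarrow> nat \<Rightarrow> bool" where
  "forward n R x y \<longleftrightarrow> R x y \<and> colour n y = (colour n x + 1) mod 4"

definition sole :: "nat \<Rightarrow> (nat \<Rightarrow> nat \<Rightarrow> bool) \<Rightarrow> nat \<Rightarrow> nat \<Rightarrow> nat \<Rightarrow> bool" where
  "sole n R x x' y \<longleftrightarrow> colour n x = colour n x' \<and> forward n R x y \<and> \<not> forward n R x' y \<and>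
    (\<forall>z<host_size n. forward n R x z \<and> \<not> forward n R x' z \<longrightarrow> z = y)"

text \<open>
  The flag \<open>up\<close> tells, for each column, whether forward neighbourhoods shrink or grow with the
  height.
\<close>
definition grid_host :: "nat \<Rightarrow> (nat \<Rightarrow> nat \<Rightarrow> bool) \<Rightarrow> (nat \<Rightarrow> bool) \<Rightarrow> bool" where
  "grid_host n R up \<longleftrightarrow> (\<forall>x\<in>cells n. \<forall>x'<host_size n. \<forall>y<host_size n.
    sole n R x x' y \<longleftrightarrow>
      y = x + (n + 2) \<and> x' = (if up (x div (n + 2)) then x + 1 else x - 1))"

definition host_params :: "nat \<Rightarrow> nat set list" where
  "host_params n = map (\<lambda>c. {v. v < host_size n \<and> colour n v = c}) [0, 1, 2, 3] @ [cells n]"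

lemma colour_cases: "colour n v = 0 \<or> colour n v = 1 \<or> colour n v = 2 \<or> colour n v = 3"
proof -
  have "colour n v < 4" by (simp add: colour_def)
  then show ?thesis by arith
qed

lemma nth_host_params:
  "host_params n ! 0 = {v. v < host_size n \<and> colour n v = 0}"
  "host_params n ! 1 = {v. v < host_size n \<and> colour n v = 1}"
  "host_params n ! Suc 0 = {v. v < host_size n \<and> colour n v = 1}"
  "host_params n ! 2 = {v. v < host_size n \<and> colour n v = 2}"
  "host_params n ! 3 = {v. v < host_size n \<and> colour n v = 3}"
  "host_params n ! 4 = cells n"
  by (simp_all add: host_params_def numeral_2_eq_2 numeral_3_eq_3 numeral_eq_Suc)

section \<open>Meaning of the formulas in a host graph\<close>

lemma sat_same_colour_fm:
  assumes "e x < host_size n" "e y < host_size n"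
  shows "sat G e ((!) (host_params n)) (same_colour_fm x y) \<longleftrightarrow> colour n (e x) = colour n (e y)"
  using assms colour_cases[of n "e x"]
  by (auto simp: same_colour_fm_def nth_host_params)

lemma sat_forward_fm:
  assumes "e x < host_size n" "e y < host_size n"
  shows "sat (graph_on (host_size n) R) e ((!) (host_params n)) (forward_fm x y) \<longleftrightarrow>
    forward n R (e x) (e y)"
  using assms colour_cases[of n "e x"]
  by (auto simp: forward_fm_def forward_def nth_host_params)

lemma sat_sole_fm:
  assumes "e x < host_size n" "e x' < host_size n" "e y < host_size n" "z \<notin> {x, x', y}"
  shows "sat (graph_on (host_size n) R) e ((!) (host_params n)) (sole_fm x x' y z) \<longleftrightarrow>
    sole n R (e x) (e x') (e y)"
  using assms by (auto simp: sole_fm_def sole_def sat_same_colour_fm sat_forward_fm)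

text \<open>Even the vertex above the right neighbour of a cell is in the host: cells end at column
  \<open>n - 1\<close> and height \<open>n\<close>, and the guards add one more of each.\<close>

lemma cells_less_host_size: "x \<in> cells n \<Longrightarrow> x + 1 + (n + 2) < host_size n"
proof -
  assume "x \<in> cells n"
  then obtain i j where x: "x = i * (n + 2) + j" "i < n" "1 \<le> j" "j \<le> n"
    by (auto simp: cells_def)
  have "i * (n + 2) + (n + 2) \<le> n * (n + 2)"
    using mult_le_mono1[of "Suc i" n "n + 2"] x(2) by simp
  with x show ?thesis by (simp add: host_size_def)
qed

lemma cell_div_mod:
  fixes i j n :: nat
  assumes "j < n + 2"
  shows "(i * (n + 2) + j) div (n + 2) = i" "(i * (n + 2) + j) mod (n + 2) = j"
  using assms by (simp_all del: add_2_eq_Suc')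

text \<open>Cells have heights \<open>1\<close> to \<open>n\<close> while a column has heights
  \<open>0\<close> to \<open>n + 1\<close>, so one step up or down stays in the column and
  \<open>x - 1\<close> is a true predecessor.\<close>

lemma cells_neighbours:
  assumes "x \<in> cells n"
  shows "1 \<le> x" "(x + 1) div (n + 2) = x div (n + 2)" "(x - 1) div (n + 2) = x div (n + 2)"
    "(x + (n + 2)) div (n + 2) = x div (n + 2) + 1"
proof -
  obtain i j where x: "x = i * (n + 2) + j" "i < n" "1 \<le> j" "j \<le> n"
    using assms by (auto simp: cells_def)
  show "1 \<le> x" using x by simp
  have "x + 1 = i * (n + 2) + (j + 1)" "x - 1 = i * (n + 2) + (j - 1)" using x by auto
  then show "(x + 1) div (n + 2) = x div (n + 2)" "(x - 1) div (n + 2) = x div (n + 2)"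
    using x cell_div_mod(1)[of "j + 1" n i] cell_div_mod(1)[of "j - 1" n i]
      cell_div_mod(1)[of j n i] by (simp_all del: add_2_eq_Suc')
  show "(x + (n + 2)) div (n + 2) = x div (n + 2) + 1"
    by (rule div_add_self2) simp
qed

text \<open>By \<open>grid_host\<close>, quantifying \<open>y\<close> away in \<open>sole\<close>
  leaves the vertical step and quantifying \<open>x'\<close> away leaves the horizontal one, because
  the guards keep both witnesses in the host.\<close>

lemma interp_graph_host:
  assumes host: "grid_host n R up"
  defines "H \<equiv> interp_graph grid_interp (graph_on (host_size n) R) (host_params n)"
  shows "pverts H = cells n"
    and "(x, y) \<in> parcs H \<longleftrightarrow> x \<in> cells n \<and> y \<in> cells n \<and>
      (y = x + 1 \<or> x = y + 1 \<or> y = x + (n + 2) \<or> x = y + (n + 2))"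
proof -
  let ?G = "graph_on (host_size n) R"
  have lt: "v < host_size n" if "v \<in> cells n" for v
    using cells_less_host_size[OF that] by simp
  have V: "interp_verts grid_interp ?G (host_params n) = cells n"
    using lt by (auto simp: interp_verts_def grid_interp_def nth_host_params)
  then show "pverts H = cells n" by (simp add: H_def interp_graph_def)
  define step where "step v = (if up (v div (n + 2)) then v + 1 else v - 1)" for v
  have sole: "sole n R v v' w \<longleftrightarrow> w = v + (n + 2) \<and> v' = step v"
    if "v \<in> cells n" "v' < host_size n" "w < host_size n" for v v' w
    using host that by (simp add: grid_host_def step_def)
  have vertical: "(\<exists>w<host_size n. sole n R v v' w) \<longleftrightarrow> v' = step v"
    if "v \<in> cells n" "v' < host_size n" for v v'
  proof -
    have "v + (n + 2) < host_size n" using cells_less_host_size[OF that(1)] by simp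
    then show ?thesis using sole[OF that] by blast
  qed
  have horizontal: "(\<exists>v'<host_size n. sole n R v v' w) \<longleftrightarrow> w = v + (n + 2)"
    if "v \<in> cells n" "w < host_size n" for v w
  proof -
    have "step v < host_size n"
      using cells_less_host_size[OF that(1)] by (auto simp: step_def)
    then show ?thesis using sole[OF that(1) _ that(2)] by auto
  qed
  \<comment> \<open>Vertical neighbours share a column and hence the flag \<open>up\<close>; after
    symmetrisation its value no longer matters.\<close>
  have steps: "v' = step v \<or> v = step v' \<longleftrightarrow> v' = v + 1 \<or> v = v' + 1"
    if "v \<in> cells n" "v' \<in> cells n" for v v'
    using cells_neighbours[OF that(1)] cells_neighbours[OF that(2)]
    unfolding step_def by (auto simp del: add_2_eq_Suc')
  show "(x, y) \<in> parcs H \<longleftrightarrow> x \<in> cells n \<and> y \<in> cells n \<and>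
      (y = x + 1 \<or> x = y + 1 \<or> y = x + (n + 2) \<or> x = y + (n + 2))"
  proof (cases "x \<in> cells n \<and> y \<in> cells n")
    case True
    let ?e = "(\<lambda>_. undefined)(0 := x, 1 := y) :: nat \<Rightarrow> nat"
    have "sat ?G ?e ((!) (host_params n)) (edge_formula grid_interp) \<longleftrightarrow>
      ((\<exists>w<host_size n. sole n R x y w) \<or> (\<exists>w<host_size n. sole n R y x w)) \<or>
      ((\<exists>w<host_size n. sole n R x w y) \<or> (\<exists>w<host_size n. sole n R y w x))"
      using True lt by (auto simp: grid_interp_def sat_sole_fm)
    also have "\<dots> \<longleftrightarrow> (y = step x \<or> x = step y) \<or> (y = x + (n + 2) \<or> x = y + (n + 2))"
      using True lt by (simp only: vertical horizontal)
    also have "\<dots> \<longleftrightarrow> (y = x + 1 \<or> x = y + 1) \<or> (y = x + (n + 2) \<or> x = y + (n + 2))"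
      using steps True by simp
    finally show ?thesis
      using True by (auto simp: H_def interp_graph_def V)
  next
    case False
    then show ?thesis by (auto simp: H_def interp_graph_def V)
  qed
qed

section \<open>Isomorphism with the square grid\<close>

lemma square_grid_simps:
  "pverts (square_grid n) = {1..n} \<times> {1..n}"
  "((i, j), (i', j')) \<in> parcs (square_grid n) \<longleftrightarrow>
    i \<in> {1..n} \<and> j \<in> {1..n} \<and> i' \<in> {1..n} \<and> j' \<in> {1..n} \<and>
    (i = i' \<and> (j' = j + 1 \<or> j = j' + 1) \<or> j = j' \<and> (i' = i + 1 \<or> i = i' + 1))"
  by (auto simp: square_grid_def Let_def)

text \<open>Arcs are pairs of vertices, so a vertex bijection \<open>f\<close> induces the arc map
  \<open>map_prod f f\<close>, with tail and head read off as \<open>fst\<close> and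
  \<open>snd\<close>.\<close>

lemma digraph_iso_with_projI:
  fixes f :: "'a \<Rightarrow> 'b"
  assumes "pair_wf_digraph H" and bij: "bij_betw f (pverts H) (pverts K)"
    and "pair_wf_digraph K"
    and arcs: "\<And>u v. u \<in> pverts H \<Longrightarrow> v \<in> pverts H \<Longrightarrow>
      (f u, f v) \<in> parcs K \<longleftrightarrow> (u, v) \<in> parcs H"
  shows "digraph_iso (with_proj H) (with_proj K)"
proof -
  interpret H: pair_wf_digraph H by fact
  interpret K: pair_wf_digraph K by fact
  let ?h = "\<lparr> iso_verts = f, iso_arcs = map_prod f f, iso_head = snd, iso_tail = fst \<rparr>"
  have inj: "inj_on f (pverts H)" and img: "f ` pverts H = pverts K"
    using bij by (auto simp: bij_betw_def)
  have sub: "parcs H \<subseteq> pverts H \<times> pverts H" using H.wellformed' by auto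
  have "inj_on (map_prod f f) (parcs H)"
    using map_prod_inj_on[OF inj inj] sub by (rule inj_on_subset)
  then have iso: "pre_digraph.digraph_isomorphism (with_proj H) ?h"
    using inj H.wf_digraph_axioms by (simp add: pre_digraph.digraph_isomorphism_def)
  have "map_prod f f ` parcs H = parcs K"
  proof (intro equalityI subsetI)
    fix e assume "e \<in> map_prod f f ` parcs H"
    then show "e \<in> parcs K" using arcs sub by auto
  next
    fix e assume e: "e \<in> parcs K"
    then obtain u v where uv: "e = (f u, f v)" "u \<in> pverts H" "v \<in> pverts H"
      using K.wellformed' img by (metis imageE surj_pair)
    then have "(u, v) \<in> parcs H" using arcs e by simp
    then show "e \<in> map_prod f f ` parcs H" using uv by force
  qed
  then have "with_proj K = app_iso ?h (with_proj H)"
    using img by (simp add: app_iso_def with_proj_def)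
  with iso show ?thesis unfolding digraph_iso_def by blast
qed

lemma digraph_iso_grid:
  assumes V: "pverts H = cells n"
    and E: "\<And>x y. (x, y) \<in> parcs H \<longleftrightarrow> x \<in> cells n \<and> y \<in> cells n \<and>
      (y = x + 1 \<or> x = y + 1 \<or> y = x + (n + 2) \<or> x = y + (n + 2))"
  shows "digraph_iso (with_proj H) (with_proj (square_grid n))"
proof -
  \<comment> \<open>Columns count from 0 but the heights of cells from 1, so only the first
    coordinate is shifted to reach \<open>{1..n}\<close>.\<close>
  let ?f = "\<lambda>x. (x div (n + 2) + 1, x mod (n + 2))"
  have cell: "x div (n + 2) < n \<and> 1 \<le> x mod (n + 2) \<and> x mod (n + 2) \<le> n" if "x \<in> cells n" for x
    using that cell_div_mod by (auto simp: cells_def)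
  show ?thesis
  proof (rule digraph_iso_with_projI[where f = ?f])
    show "pair_wf_digraph H" by unfold_locales (auto simp: V E)
    show "pair_wf_digraph (square_grid n)"
      by unfold_locales (auto simp: square_grid_simps)
    show "bij_betw ?f (pverts H) (pverts (square_grid n))"
      unfolding V square_grid_simps
    proof (rule bij_betw_byWitness[where f' = "\<lambda>(i, j). (i - 1) * (n + 2) + j"])
      show "\<forall>x\<in>cells n. (case ?f x of (i, j) \<Rightarrow> (i - 1) * (n + 2) + j) = x"
        by (auto simp only: prod.case add_diff_cancel_right' div_mult_mod_eq)
      show "\<forall>p\<in>{1..n} \<times> {1..n}. ?f (case p of (i, j) \<Rightarrow> (i - 1) * (n + 2) + j) = p"
        by (auto simp: cell_div_mod simp del: add_2_eq_Suc')
      show "?f ` cells n \<subseteq> {1..n} \<times> {1..n}"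
        using cell by fastforce
      show "(\<lambda>(i, j). (i - 1) * (n + 2) + j) ` ({1..n} \<times> {1..n}) \<subseteq> cells n"
      proof
        fix x assume "x \<in> (\<lambda>(i, j). (i - 1) * (n + 2) + j) ` ({1..n} \<times> {1..n})"
        then obtain i j where "x = (i - 1) * (n + 2) + j" "i - 1 < n" "1 \<le> j" "j \<le> n"
          by fastforce
        then show "x \<in> cells n" unfolding cells_def by blast
      qed
    qed
    fix x y assume "x \<in> pverts H" "y \<in> pverts H"
    then have xy: "x \<in> cells n" "y \<in> cells n" by (simp_all add: V)
    define i j i' j' where "i = x div (n + 2)" and "j = x mod (n + 2)"
      and "i' = y div (n + 2)" and "j' = y mod (n + 2)"
    have b: "i < n" "1 \<le> j" "j \<le> n" "i' < n" "1 \<le> j'" "j' \<le> n"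
      using cell[OF xy(1)] cell[OF xy(2)] by (simp_all only: i_def j_def i'_def j'_def)
    \<comment> \<open>Adding 1 raises the remainder without a carry, thanks to the upper guard;
      adding \<open>n + 2\<close> raises the quotient only.\<close>
    have shift: "v = u + 1 \<longleftrightarrow> v div (n + 2) = u div (n + 2) \<and> v mod (n + 2) = u mod (n + 2) + 1"
      "v = u + (n + 2) \<longleftrightarrow> v div (n + 2) = u div (n + 2) + 1 \<and> v mod (n + 2) = u mod (n + 2)"
      if "u \<in> cells n" "v \<in> cells n" for u v
    proof -
      have u: "u = u div (n + 2) * (n + 2) + u mod (n + 2)"
        by (simp only: div_mult_mod_eq)
      have v: "v = v div (n + 2) * (n + 2) + v mod (n + 2)"
        by (simp only: div_mult_mod_eq)
      show "v = u + 1 \<longleftrightarrow> v div (n + 2) = u div (n + 2) \<and> v mod (n + 2) = u mod (n + 2) + 1"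
      proof
        assume vu: "v = u + 1"
        then have d: "v div (n + 2) = u div (n + 2)"
          using cells_neighbours(2)[OF that(1)] by simp
        with vu u v show "v div (n + 2) = u div (n + 2) \<and> v mod (n + 2) = u mod (n + 2) + 1"
          by (metis add.assoc add_left_cancel)
      qed (metis u v add.assoc)
      show "v = u + (n + 2) \<longleftrightarrow> v div (n + 2) = u div (n + 2) + 1 \<and> v mod (n + 2) = u mod (n + 2)"
      proof
        assume "v div (n + 2) = u div (n + 2) + 1 \<and> v mod (n + 2) = u mod (n + 2)"
        then have "v = (u div (n + 2) + 1) * (n + 2) + u mod (n + 2)" using v by metis
        also have "\<dots> = (u div (n + 2) * (n + 2) + u mod (n + 2)) + (n + 2)"
          by (simp only: add_mult_distrib mult_1 add_ac)
        finally show "v = u + (n + 2)" using u by metis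
      next
        assume "v = u + (n + 2)"
        then show "v div (n + 2) = u div (n + 2) + 1 \<and> v mod (n + 2) = u mod (n + 2)"
          using cells_neighbours(4)[OF that(1)] mod_add_self2[of u "n + 2"] by simp
      qed
    qed
    have "(?f x, ?f y) \<in> parcs (square_grid n) \<longleftrightarrow>
      (i = i' \<and> (j' = j + 1 \<or> j = j' + 1) \<or> j = j' \<and> (i' = i + 1 \<or> i = i' + 1))"
      using b unfolding square_grid_simps i_def[symmetric] j_def[symmetric] i'_def[symmetric]
        j'_def[symmetric] by auto
    also have "\<dots> \<longleftrightarrow> (y = x + 1 \<or> x = y + 1 \<or> y = x + (n + 2) \<or> x = y + (n + 2))"
      unfolding shift[OF xy] shift[OF xy(2,1)] i_def j_def i'_def j'_def by (auto simp only:)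
    also have "\<dots> \<longleftrightarrow> (x, y) \<in> parcs H"
      using xy by (simp only: E simp_thms)
    finally show "(?f x, ?f y) \<in> parcs (square_grid n) \<longleftrightarrow> (x, y) \<in> parcs H" .
  qed
qed

text \<open>The host for \<open>m\<close> yields the grid of side \<open>m\<close> itself, so
  \<open>m\<close> serves as the required \<open>n \<ge> m\<close>.\<close>

lemma interprets_grids_if_hosts:
  assumes "\<And>n. grid_host n (R n) (up n)" and "\<And>n. graph_on (host_size n) (R n) \<in> C"
  shows "interprets_grids C"
proof -
  have "\<exists>H\<in>interp_class grid_interp C. digraph_iso (with_proj H) (with_proj (square_grid m))" for m
  proof
    let ?H = "interp_graph grid_interp (graph_on (host_size m) (R m)) (host_params m)"
    show "digraph_iso (with_proj ?H) (with_proj (square_grid m))"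
      by (rule digraph_iso_grid) (simp_all only: interp_graph_host[OF assms(1)])
    have "\<forall>A\<in>set (host_params m). A \<subseteq> {..<host_size m}"
      using cells_less_host_size[of _ m] by (fastforce simp: host_params_def)
    moreover have "length (host_params m) = num_params grid_interp"
      by (simp add: host_params_def grid_interp_def)
    ultimately show "?H \<in> interp_class grid_interp C"
      unfolding interp_class_def using assms(2)[of m] graph_on_simps(1) by blast
  qed
  then show ?thesis
    unfolding interprets_grids_def using mso_interpretation_grid_interp by blast
qed

section \<open>Threshold conditions that yield grid hosts\<close>

lemma colour_next_column:
  "y div (n + 2) = x div (n + 2) + 1 \<Longrightarrow> colour n y = (colour n x + 1) mod 4"
  by (simp add: colour_def mod_Suc_eq)

lemma even_colour_iff: "even (colour n v) \<longleftrightarrow> even (v div (n + 2))"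
  by (simp add: colour_def dvd_mod_iff)

text \<open>These are the test vertices for the uniqueness clause of \<open>sole\<close>: if
  \<open>x'\<close> is too far from \<open>x\<close>, two consecutive ones of them lie in the
  difference of the forward neighbourhoods.\<close>

lemma cells_columns:
  assumes "x \<in> cells n"
  shows "(x - 1 + (n + 2)) div (n + 2) = x div (n + 2) + 1"
    "(x + (n + 2)) div (n + 2) = x div (n + 2) + 1"
    "(x + 1 + (n + 2)) div (n + 2) = x div (n + 2) + 1"
proof -
  have "(z + (n + 2)) div (n + 2) = z div (n + 2) + 1" for z
    by (rule div_add_self2) simp
  then show "(x - 1 + (n + 2)) div (n + 2) = x div (n + 2) + 1"
    "(x + (n + 2)) div (n + 2) = x div (n + 2) + 1"
    "(x + 1 + (n + 2)) div (n + 2) = x div (n + 2) + 1"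
    by (simp_all only: cells_neighbours[OF assms])
qed

text \<open>For \<open>x\<close> and \<open>x'\<close> of one colour, the forward difference
  consists of the vertices of the next colour in a half-open interval: above
  \<open>x' + (n + 2)\<close> and up to \<open>x + (n + 2)\<close> in even columns, from
  \<open>x + (n + 2)\<close> to below \<open>x' + (n + 2)\<close> in odd ones. If nonempty it
  contains \<open>x + (n + 2)\<close>, and a second vertex next to that one unless \<open>x'\<close>
  is just one step from \<open>x\<close>.\<close>

lemma grid_host_if_thresholds:
  assumes R: "\<And>x y. colour n y = (colour n x + 1) mod 4 \<Longrightarrow>
    R x y \<longleftrightarrow> (if even (colour n x) then y \<le> x + (n + 2) else x + (n + 2) \<le> y)"
  shows "grid_host n R odd"
  unfolding grid_host_def
proof (intro ballI allI impI)
  fix x x' y assume x: "x \<in> cells n" and x': "x' < host_size n" and y: "y < host_size n"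
  define N where "N = n + 2"
  note lt = cells_less_host_size[OF x, folded N_def]
  note near = cells_neighbours[OF x, folded N_def]
  let ?next = "\<lambda>z. colour n z = (colour n x + 1) mod 4"
  note nxt = cells_columns[OF x, THEN colour_next_column, folded N_def]
  have same: "colour n (x - 1) = colour n x" "colour n (x + 1) = colour n x"
    using near by (simp_all add: colour_def N_def)
  show "sole n R x x' y \<longleftrightarrow>
    y = x + (n + 2) \<and> x' = (if odd (x div (n + 2)) then x + 1 else x - 1)"
    unfolding N_def[symmetric]
  proof (cases "colour n x = colour n x'")
    \<comment> \<open>The vertices \<open>x - 1\<close> and \<open>x + 1\<close> have the colour of
      \<open>x\<close>, so both sides fail when the colours differ.\<close>
    case False
    then show "sole n R x x' y \<longleftrightarrow> y = x + N \<and> x' = (if odd (x div N) then x + 1 else x - 1)"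
      using same by (auto simp: sole_def)
  next
    case c: True
    show "sole n R x x' y \<longleftrightarrow> y = x + N \<and> x' = (if odd (x div N) then x + 1 else x - 1)"
    proof (cases "even (x div N)")
      case True
      then have fw: "forward n R x z \<longleftrightarrow> ?next z \<and> z \<le> x + N"
        "forward n R x' z \<longleftrightarrow> ?next z \<and> z \<le> x' + N" for z
        using R c even_colour_iff[of n x] by (auto simp: forward_def N_def)
      show ?thesis
      proof
        assume "sole n R x x' y"
        then have s: "y \<le> x + N" "x' + N < y"
          "\<And>z. z < host_size n \<Longrightarrow> ?next z \<Longrightarrow> z \<le> x + N \<Longrightarrow> x' + N < z \<Longrightarrow> z = y"
          by (auto simp: sole_def fw)
        have "y = x + N" using s(3)[of "x + N"] nxt lt s(1,2) by auto
        moreover have "\<not> x' + 1 < x"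
        proof
          assume "x' + 1 < x"
          then have "x - 1 + N = y" by (intro s(3) nxt(1)) (use lt in auto)
          with \<open>y = x + N\<close> show False using near(1) by simp
        qed
        ultimately have "y = x + N" "x' = x - 1" using s(2) by auto
        then show "y = x + N \<and> x' = (if odd (x div N) then x + 1 else x - 1)"
          using True by simp
      next
        assume "y = x + N \<and> x' = (if odd (x div N) then x + 1 else x - 1)"
        then have "y = x + N" "x = x' + 1" using True near(1) by auto
        then show "sole n R x x' y"
          unfolding sole_def fw using c nxt by auto
      qed
    next
      case False
      then have fw: "forward n R x z \<longleftrightarrow> ?next z \<and> x + N \<le> z"
        "forward n R x' z \<longleftrightarrow> ?next z \<and> x' + N \<le> z" for z
        using R c even_colour_iff[of n x] by (auto simp: forward_def N_def)
      show ?thesis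
      proof
        assume "sole n R x x' y"
        then have s: "x + N \<le> y" "y < x' + N"
          "\<And>z. z < host_size n \<Longrightarrow> ?next z \<Longrightarrow> x + N \<le> z \<Longrightarrow> z < x' + N \<Longrightarrow> z = y"
          by (auto simp: sole_def fw)
        have "y = x + N" using s(3)[of "x + N"] nxt lt s(1,2) by auto
        moreover have "x' = x + 1"
          using s(3)[of "x + 1 + N"] nxt lt s(1,2) calculation
          by (cases "x + 1 < x'") auto
        ultimately show "y = x + N \<and> x' = (if odd (x div N) then x + 1 else x - 1)"
          using False by simp
      next
        assume "y = x + N \<and> x' = (if odd (x div N) then x + 1 else x - 1)"
        then show "sole n R x x' y"
          unfolding sole_def fw using False c nxt by auto
      qed
    qed
  qed
qed

text \<open>If \<open>x'\<close> lies in another column, nothing cancels and both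
  \<open>x + (n + 2)\<close> and \<open>x - 1 + (n + 2)\<close> remain in the difference. Within one
  column the difference is an interval ending at \<open>x + (n + 2)\<close>, a single vertex only
  for \<open>x' = x - 1\<close>.\<close>

lemma grid_host_if_local:
  assumes R: "\<And>x y. colour n y = (colour n x + 1) mod 4 \<Longrightarrow>
    R x y \<longleftrightarrow> y div (n + 2) = x div (n + 2) + 1 \<and> y \<le> x + (n + 2)"
  shows "grid_host n R (\<lambda>_. False)"
  unfolding grid_host_def if_False
proof (intro ballI allI impI)
  fix x x' y assume x: "x \<in> cells n" and x': "x' < host_size n" and y: "y < host_size n"
  define N where "N = n + 2"
  note lt = cells_less_host_size[OF x, folded N_def]
  note cols = cells_columns[OF x, folded N_def]
  note near = cells_neighbours[OF x, folded N_def]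
  have fw: "forward n R u z \<longleftrightarrow> z div N = u div N + 1 \<and> z \<le> u + N" for u z
    using R[of z u] colour_next_column[of z n u] by (auto simp: forward_def N_def)
  show "sole n R x x' y \<longleftrightarrow> y = x + (n + 2) \<and> x' = x - 1"
    unfolding N_def[symmetric]
  proof
    assume sole: "sole n R x x' y"
    then have s: "\<And>z. z < host_size n \<Longrightarrow> z div N = x div N + 1 \<Longrightarrow> z \<le> x + N \<Longrightarrow>
        \<not> (z div N = x' div N + 1 \<and> z \<le> x' + N) \<Longrightarrow> z = y"
      and y: "y div N = x div N + 1" "y \<le> x + N" "\<not> (y div N = x' div N + 1 \<and> y \<le> x' + N)"
      by (auto simp: sole_def fw)
    have col: "x' div N = x div N"
    proof (rule ccontr)
      assume "x' div N \<noteq> x div N"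
      then have "x + N = y" "x - 1 + N = y"
        using s[of "x + N"] s[of "x - 1 + N"] cols lt by auto
      then show False using near(1) by simp
    qed
    then have "x' + N < y" using y by auto
    then have "x + N = y" using s[of "x + N"] cols lt y(2) by auto
    moreover have "\<not> x' + 1 < x"
    proof
      assume "x' + 1 < x"
      then have "x - 1 + N = y" by (intro s) (use cols lt in auto)
      with \<open>x + N = y\<close> show False using near(1) by simp
    qed
    ultimately have "x + N = y" "x' = x - 1" using \<open>x' + N < y\<close> by auto
    then show "y = x + N \<and> x' = x - 1" by simp
  next
    assume "y = x + N \<and> x' = x - 1"
    then show "sole n R x x' y"
      using near cols by (auto simp: sole_def fw colour_def N_def)
  qed
qed

subsection \<open>Unit interval graphs and bipartite permutation graphs\<close>

text \<open>This is the power of order \<open>n + 2\<close> of the path on the naturals.\<close>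

definition near :: "nat \<Rightarrow> nat \<Rightarrow> nat \<Rightarrow> bool" where
  "near n u v \<longleftrightarrow> u \<noteq> v \<and> u \<le> v + (n + 2) \<and> v \<le> u + (n + 2)"

text \<open>Dropping the edges between columns of equal parity makes the graph bipartite and keeps
  every edge between consecutive columns.\<close>

definition near_across :: "nat \<Rightarrow> nat \<Rightarrow> nat \<Rightarrow> bool" where
  "near_across n u v \<longleftrightarrow> near n u v \<and> even (u div (n + 2)) \<noteq> even (v div (n + 2))"

text \<open>Adjacent vertices are at most one column apart, and among the column differences -1, 0
  and 1 only 1 is congruent to 1 modulo 4. The remaining bound \<open>x \<le> y + (n + 2)\<close>
  then holds because \<open>x < y\<close>.\<close>

lemma near_iff:
  assumes "colour n y = (colour n x + 1) mod 4"
  shows "near n x y \<longleftrightarrow> y div (n + 2) = x div (n + 2) + 1 \<and> y \<le> x + (n + 2)"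
proof
  assume near: "near n x y"
  have "y div (n + 2) \<le> (x + (n + 2)) div (n + 2)" "x div (n + 2) \<le> (y + (n + 2)) div (n + 2)"
    using near by (auto simp: near_def intro!: div_le_mono)
  then have le: "y div (n + 2) \<le> x div (n + 2) + 1" "x div (n + 2) \<le> y div (n + 2) + 1"
    using div_add_self2[of "n + 2"] by simp_all
  have "y div (n + 2) mod 4 = (x div (n + 2) mod 4 + 1) mod 4"
    using assms by (simp only: colour_def)
  moreover have "j = i + 1" if "j mod 4 = (i mod 4 + 1) mod 4" "j \<le> i + 1" "i \<le> j + 1" for i j :: nat
  proof -
    have "k mod 4 \<noteq> (k mod 4 + 1) mod 4" "k mod 4 \<noteq> ((k + 1) mod 4 + 1) mod 4" for k :: nat
      by presburger+
    then have "j \<noteq> i" "i \<noteq> j + 1" using that(1) by auto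
    with that(2,3) show ?thesis by linarith
  qed
  ultimately have "y div (n + 2) = x div (n + 2) + 1" using le by blast
  with near show "y div (n + 2) = x div (n + 2) + 1 \<and> y \<le> x + (n + 2)"
    by (simp add: near_def)
next
  assume *: "y div (n + 2) = x div (n + 2) + 1 \<and> y \<le> x + (n + 2)"
  then have "x < y" using div_le_mono[of y x "n + 2"] by (auto simp: not_le[symmetric])
  with * show "near n x y" by (simp add: near_def)
qed

lemma grid_host_near: "grid_host n (near n) (\<lambda>_. False)"
  by (rule grid_host_if_local) (rule near_iff)

lemma grid_host_near_across: "grid_host n (near_across n) (\<lambda>_. False)"
  by (rule grid_host_if_local) (auto simp: near_across_def near_iff)

text \<open>Let the interval of \<open>v\<close> start at \<open>v / (n + 2)\<close>: closed unit
  intervals meet exactly if their left ends differ by at most 1.\<close>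

lemma unit_interval_graph_near: "unit_interval_graph (graph_on L (near n))"
proof -
  have "near n u v \<longleftrightarrow> u \<noteq> v \<and>
    {real u / real (n + 2)..real u / real (n + 2) + 1} \<inter>
    {real v / real (n + 2)..real v / real (n + 2) + 1} \<noteq> {}" for u v
  proof -
    have le: "real a / real (n + 2) \<le> real b / real (n + 2) + 1 \<longleftrightarrow> a \<le> b + (n + 2)" for a b
    proof -
      have "real b / real (n + 2) + 1 = real (b + (n + 2)) / real (n + 2)"
        by (simp add: field_simps)
      then show ?thesis
        by (simp only: divide_le_cancel of_nat_le_iff) simp
    qed
    show ?thesis
      unfolding near_def Int_atLeastAtMost
      using le[of u v] le[of v u] by auto
  qed
  moreover have "pair_graph (graph_on L (near n))"
    by (rule pair_graph_graph_on) (auto simp: near_def)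
  ultimately show ?thesis
    unfolding unit_interval_graph_def
    by (intro conjI exI[of _ "\<lambda>v. real v / real (n + 2)"]) auto
qed

lemma pair_graph_near_across: "pair_graph (graph_on L (near_across n))"
  by (rule pair_graph_graph_on) (auto simp: near_across_def near_def)

lemma bipartite_graph_near_across: "bipartite_graph (graph_on L (near_across n))"
proof -
  have "bipartition (graph_on L (near_across n))
    {v. v < L \<and> even (v div (n + 2))} {v. v < L \<and> odd (v div (n + 2))}"
    by (auto simp: bipartition_def independent_set_def near_across_def)
  then show ?thesis
    unfolding bipartite_graph_def using pair_graph_near_across by blast
qed

text \<open>On columns of one parity both keys increase with \<open>v\<close>, so nothing is
  inverted. Across parities, one of the two key comparisons says \<open>u \<le> v + (n + 2)\<close>
  and the other \<open>v \<le> u + (n + 2)\<close>; inversion means both. Doubling and adding 1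
  keeps the keys of the two parities distinct and turns strict into weak inequalities.\<close>

lemma permutation_graph_near_across: "permutation_graph (graph_on L (near_across n))"
proof -
  define a b :: "nat \<Rightarrow> int" where
    "a v = (if even (v div (n + 2)) then 2 * int v else 2 * int v + 2 * int (n + 2) + 1)" and
    "b v = (if even (v div (n + 2)) then 2 * int v + 2 * int (n + 2) + 1 else 2 * int v)" for v
  have "even (a v) \<longleftrightarrow> even (v div (n + 2))" "even (b v) \<longleftrightarrow> odd (v div (n + 2))" for v
    by (simp_all add: a_def b_def)
  then have parity: "even (u div (n + 2)) = even (v div (n + 2))"
    if "a u = a v \<or> b u = b v" for u v
    using that by metis
  have "inj_on a {..<L}" "inj_on b {..<L}"
    by (rule inj_onI, frule parity[OF disjI1] parity[OF disjI2], simp add: a_def b_def split: if_splits)+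
  moreover have "near_across n u v \<longleftrightarrow> (a u < a v \<and> b v < b u) \<or> (a v < a u \<and> b u < b v)" for u v
  proof -
    define p q N where "p = int u" and "q = int v" and "N = int (n + 2)"
    have N: "N > 0" by (simp add: N_def)
    have near: "near n u v \<longleftrightarrow> p \<noteq> q \<and> p \<le> q + N \<and> q \<le> p + N"
      by (auto simp: near_def p_def q_def N_def)
    have less: "2 * p < 2 * q + 2 * N + 1 \<longleftrightarrow> p \<le> q + N" "2 * q < 2 * p + 2 * N + 1 \<longleftrightarrow> q \<le> p + N"
      by presburger+
    show ?thesis
      unfolding near_across_def near a_def b_def p_def[symmetric] q_def[symmetric] N_def[symmetric]
      using N less
      by (cases "even (u div (n + 2))"; cases "even (v div (n + 2))"; cases "u = v")
        (auto simp: p_def q_def)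
  qed
  ultimately show ?thesis
    unfolding permutation_graph_iff_keys using pair_graph_near_across by fastforce
qed

subsection \<open>Bichain graphs and split permutation graphs\<close>

text \<open>Both thresholds run the same way: with colours fixed, a link persists when
  \<open>p\<close> grows or \<open>q\<close> shrinks. This makes every colour class a chain.\<close>

definition linked :: "nat \<Rightarrow> nat \<Rightarrow> nat \<Rightarrow> bool" where
  "linked n p q \<longleftrightarrow> even (colour n p) \<and> odd (colour n q) \<and>
    (if colour n q = (colour n p + 1) mod 4 then q \<le> p + (n + 2) else q + (n + 2) \<le> p)"

definition bichain_rel :: "nat \<Rightarrow> nat \<Rightarrow> nat \<Rightarrow> bool" where
  "bichain_rel n u v \<longleftrightarrow> linked n u v \<or> linked n v u"

definition split_rel :: "nat \<Rightarrow> nat \<Rightarrow> nat \<Rightarrow> bool" where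
  "split_rel n u v \<longleftrightarrow>
    bichain_rel n u v \<or> u \<noteq> v \<and> even (colour n u) \<and> even (colour n v)"

text \<open>For odd \<open>x\<close> the edge is \<open>linked n y x\<close>, where \<open>x\<close>
  has the colour before that of \<open>y\<close>; the second branch of \<open>linked\<close> then
  gives the reversed threshold.\<close>

lemma bichain_rel_iff:
  assumes "colour n y = (colour n x + 1) mod 4"
  shows "bichain_rel n x y \<longleftrightarrow>
    (if even (colour n x) then y \<le> x + (n + 2) else x + (n + 2) \<le> y)"
  using assms colour_cases[of n x] by (auto simp: bichain_rel_def linked_def)

lemma grid_host_bichain_rel: "grid_host n (bichain_rel n) odd"
  by (rule grid_host_if_thresholds) (rule bichain_rel_iff)

text \<open>The clique edges join two even colours, whereas a forward pair has colours of opposite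
  parity.\<close>

lemma grid_host_split_rel: "grid_host n (split_rel n) odd"
proof (rule grid_host_if_thresholds)
  fix x y assume c: "colour n y = (colour n x + 1) mod 4"
  then have "split_rel n x y \<longleftrightarrow> bichain_rel n x y"
    using colour_cases[of n x] by (auto simp: split_rel_def)
  then show "split_rel n x y \<longleftrightarrow>
    (if even (colour n x) then y \<le> x + (n + 2) else x + (n + 2) \<le> y)"
    using bichain_rel_iff[OF c] by simp
qed

lemma chain_bichain_rel:
  assumes "even c"
  shows "chain (graph_on L (bichain_rel n)) (filter (\<lambda>v. colour n v = c) [0..<L])"
    (is "chain ?G ?vs")
proof -
  have "sorted_wrt (\<lambda>u v. neighbourhood ?G u \<subseteq> neighbourhood ?G v) ?vs"
  proof (rule sorted_wrt_mono_rel)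
    show "sorted_wrt (<) ?vs" by (intro sorted_wrt_filter) simp
    show "neighbourhood ?G u \<subseteq> neighbourhood ?G v"
      if "u \<in> set ?vs" "v \<in> set ?vs" "u < v" for u v
      using that assms by (auto simp: neighbourhood_def bichain_rel_def linked_def split: if_splits)
  qed
  then show ?thesis by (auto simp: chain_iff_sorted_wrt)
qed

text \<open>On odd colours the vertex is the \<open>q\<close> of \<open>linked\<close>, so
  neighbourhoods shrink as it grows and the list is reversed.\<close>

lemma chain_bichain_rel_rev:
  assumes "odd c"
  shows "chain (graph_on L (bichain_rel n)) (rev (filter (\<lambda>v. colour n v = c) [0..<L]))"
    (is "chain ?G (rev ?vs)")
proof -
  have "sorted_wrt (\<lambda>v u. neighbourhood ?G u \<subseteq> neighbourhood ?G v) ?vs"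
  proof (rule sorted_wrt_mono_rel)
    show "sorted_wrt (<) ?vs" by (intro sorted_wrt_filter) simp
    show "neighbourhood ?G u \<subseteq> neighbourhood ?G v"
      if "v \<in> set ?vs" "u \<in> set ?vs" "v < u" for u v
      using that assms by (auto simp: neighbourhood_def bichain_rel_def linked_def split: if_splits)
  qed
  then show ?thesis by (auto simp: chain_iff_sorted_wrt sorted_wrt_rev)
qed

text \<open>Colours \<open>0\<close> and \<open>2\<close> are the two chains of one part, colours
  \<open>1\<close> and \<open>3\<close> those of the other.\<close>

lemma bichain_graph_bichain_rel: "bichain_graph (graph_on L (bichain_rel n))"
proof -
  let ?G = "graph_on L (bichain_rel n)"
  let ?cs = "\<lambda>c. filter (\<lambda>v. colour n v = c) [0..<L]"
  have "pair_graph ?G"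
    by (rule pair_graph_graph_on) (auto simp: bichain_rel_def linked_def)
  moreover have "bipartition ?G {v. v < L \<and> even (colour n v)} {v. v < L \<and> odd (colour n v)}"
    by (auto simp: bipartition_def independent_set_def bichain_rel_def linked_def)
  moreover have "partition_into_chains ?G 2 {v. v < L \<and> even (colour n v)}"
    unfolding partition_into_chains_def
  proof (intro exI[of _ "[?cs 0, ?cs 2]"] conjI)
    show "\<forall>c\<in>set [?cs 0, ?cs 2]. chain ?G c" by (simp add: chain_bichain_rel)
    show "set (concat [?cs 0, ?cs 2]) = {v. v < L \<and> even (colour n v)}"
    proof -
      have "even (colour n v) \<longleftrightarrow> colour n v = 0 \<or> colour n v = 2" for v
        using colour_cases[of n v] by auto
      then show ?thesis by auto
    qed
  qed auto
  moreover have "partition_into_chains ?G 2 {v. v < L \<and> odd (colour n v)}"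
    unfolding partition_into_chains_def
  proof (intro exI[of _ "[rev (?cs 1), rev (?cs 3)]"] conjI)
    show "\<forall>c\<in>set [rev (?cs 1), rev (?cs 3)]. chain ?G c"
      using chain_bichain_rel_rev[of 1] chain_bichain_rel_rev[of 3] by simp
    show "set (concat [rev (?cs 1), rev (?cs 3)]) = {v. v < L \<and> odd (colour n v)}"
    proof -
      have "odd (colour n v) \<longleftrightarrow> colour n v = 1 \<or> colour n v = 3" for v
        using colour_cases[of n v] by auto
      then show ?thesis by auto
    qed
  qed auto
  ultimately show ?thesis
    unfolding bichain_graph_def k_chain_graph_def by blast
qed

lemma pair_graph_split_rel: "pair_graph (graph_on L (split_rel n))"
  by (rule pair_graph_graph_on) (auto simp: split_rel_def bichain_rel_def linked_def)

lemma split_graph_split_rel: "split_graph (graph_on L (split_rel n))"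
proof -
  let ?K = "{v. v < L \<and> even (colour n v)}" and ?I = "{v. v < L \<and> odd (colour n v)}"
  have "?K \<union> ?I = pverts (graph_on L (split_rel n))" "?K \<inter> ?I = {}"
    "clique (graph_on L (split_rel n)) ?K" "independent_set (graph_on L (split_rel n)) ?I"
    by (auto simp: clique_def independent_set_def split_rel_def bichain_rel_def linked_def)
  then show ?thesis
    unfolding split_graph_def using pair_graph_split_rel by blast
qed

text \<open>
  The independent vertices lie on the diagonal, colour \<open>1\<close> on the positive half and colour \<open>3\<close> on
  the negative half. A clique vertex is inverted with exactly the diagonal points between its two
  keys; giving colours \<open>0\<close> and \<open>2\<close> opposite orientations inverts every pair of clique vertices.
\<close>
lemma permutation_graph_split_rel: "permutation_graph (graph_on L (split_rel n))"
proof -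
  define N where "N = int (n + 2)"
  \<comment> \<open>In absolute value, a diagonal vertex \<open>q\<close> sits at
    \<open>2 * (q + 2 * N)\<close>. Compared with it, the offset \<open>3 * N\<close> of a clique
    vertex \<open>p\<close> encodes \<open>q \<le> p + N\<close> and the offset \<open>N\<close>
    encodes \<open>q + N \<le> p\<close>. Clique keys are odd and diagonal keys even, which excludes
    ties.\<close>
  define a b :: "nat \<Rightarrow> int" where
    "a v = (if colour n v = 0 then - (2 * (int v + N) + 1)
      else if colour n v = 1 then 2 * (int v + 2 * N)
      else if colour n v = 2 then 2 * (int v + N) + 1
      else - 2 * (int v + 2 * N))" and
    "b v = (if colour n v = 0 then 2 * (int v + 3 * N) + 1
      else if colour n v = 1 then 2 * (int v + 2 * N)
      else if colour n v = 2 then - (2 * (int v + 3 * N) + 1)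
      else - 2 * (int v + 2 * N))" for v
  have pos: "N > 0" by (simp add: N_def)
  have le: "x \<le> y + (n + 2) \<longleftrightarrow> int x \<le> int y + N" "x + (n + 2) \<le> y \<longleftrightarrow> int x + N \<le> int y" for x y
    by (simp_all add: N_def) linarith+
  have "inj_on a {..<L}" "inj_on b {..<L}"
    using pos by (auto simp: inj_on_def a_def b_def split: if_splits) presburger+
  moreover have "split_rel n u v \<longleftrightarrow> (a u < a v \<and> b v < b u) \<or> (a v < a u \<and> b u < b v)" for u v
  proof -
    have "u \<noteq> v \<longleftrightarrow> int u < int v \<or> int v < int u" by auto
    then show ?thesis
      using colour_cases[of n u] colour_cases[of n v] pos
      unfolding split_rel_def bichain_rel_def linked_def le a_def b_def
      by (elim disjE) (simp_all del: of_nat_less_iff of_nat_le_iff, (arith | fastforce)+)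
  qed
  ultimately show ?thesis
    unfolding permutation_graph_iff_keys using pair_graph_split_rel by fastforce
qed

section \<open>Heredity and grids for the four classes\<close>

theorem theorem5:
  shows
    "(hereditary {G :: nat pair_pre_digraph. bichain_graph G} \<and>
      interprets_grids {G :: nat pair_pre_digraph. bichain_graph G}) \<and>
     (hereditary {G :: nat pair_pre_digraph. split_graph G \<and> permutation_graph G} \<and>
      interprets_grids {G :: nat pair_pre_digraph. split_graph G \<and> permutation_graph G}) \<and>
     (hereditary {G :: nat pair_pre_digraph. bipartite_graph G \<and> permutation_graph G} \<and>
      interprets_grids {G :: nat pair_pre_digraph. bipartite_graph G \<and> permutation_graph G}) \<and>
     (hereditary {G :: nat pair_pre_digraph. unit_interval_graph G} \<and>
      interprets_grids {G :: nat pair_pre_digraph. unit_interval_graph G})"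
proof (intro conjI)
  show "hereditary {G :: nat pair_pre_digraph. bichain_graph G}"
    unfolding hereditary_def using bichain_graph_induced by blast
  show "hereditary {G :: nat pair_pre_digraph. split_graph G \<and> permutation_graph G}"
    unfolding hereditary_def using split_graph_induced permutation_graph_induced by blast
  show "hereditary {G :: nat pair_pre_digraph. bipartite_graph G \<and> permutation_graph G}"
    unfolding hereditary_def using bipartite_graph_induced permutation_graph_induced by blast
  show "hereditary {G :: nat pair_pre_digraph. unit_interval_graph G}"
    unfolding hereditary_def using unit_interval_graph_induced by blast
  show "interprets_grids {G :: nat pair_pre_digraph. bichain_graph G}"
    by (rule interprets_grids_if_hosts[OF grid_host_bichain_rel])
      (simp add: bichain_graph_bichain_rel)
  show "interprets_grids {G :: nat pair_pre_digraph. split_graph G \<and> permutation_graph G}"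
    by (rule interprets_grids_if_hosts[OF grid_host_split_rel])
      (simp add: split_graph_split_rel permutation_graph_split_rel)
  show "interprets_grids {G :: nat pair_pre_digraph. bipartite_graph G \<and> permutation_graph G}"
    by (rule interprets_grids_if_hosts[OF grid_host_near_across])
      (simp add: bipartite_graph_near_across permutation_graph_near_across)
  show "interprets_grids {G :: nat pair_pre_digraph. unit_interval_graph G}"
    by (rule interprets_grids_if_hosts[OF grid_host_near])
      (simp add: unit_interval_graph_near)
qed

end
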